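(* Let $\{X_n\}_{n=1}^{\infty}$ be a sequence of random variables with common marginal distribution function $F$, and let $\{x_n\}_{n=1}^\infty$ be a sequence of real numbers such that $n\bar F(x_n)\to\tau$ for some $\tau>0$. Suppose $\{X_n\}$ satisfies AIM$(x_n)$, with associated sequences $q_n$ and $\alpha_n$, and let $p_n$ be a sequence of positive integers such that $$p_n=o(n),\qquad n\alpha_n=o(p_n),\qquad q_n=o(p_n).$$ Then, as $n\to\infty$, $$\mathbb{P}(M_n\le x_n)-\exp\Big\{-\sum_{j=1}^{n}\mathbb{P}(X_j>x_n,\ M_{j,j+p_n}\le x_n)\Big\}\to 0,$$ and consequently $$\mathbb{P}(M_n\le x_n)-F(x_n)^{n\gamma_n}\to 0,\qquad\text{where}\quad \gamma_n=\frac1n\sum_{j=1}^{n}\mathbb{P}(M_{j,j+p_n}\le x_n\mid X_j>x_n).$$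
   Context: Notation: $\bar F=1-F$; $M_n=\max\{X_1,\dots,X_n\}$; $M_{j,k}=\max\{X_i: j+1\le i\le k\}$; for a set $A$ of positive integers, $M(A)=\max\{X_i:i\in A\}$ and $|A|$ is its number of elements. An interval is a set of consecutive integers. No stationarity of $\{X_n\}$ is assumed. Limits and $o(\cdot)$ are as $n\to\infty$. AIM$(x_n)$ (asymptotic independence of maxima relative to $x_n$): there is a sequence $q_n$ of positive integers with $q_n=o(n)$ such that $$\alpha_n=\max\big|\mathbb{P}(M(I_1\cup I_2)\le x_n)-\mathbb{P}(M(I_1)\le x_n)\,\mathbb{P}(M(I_2)\le x_n)\big|\to 0,$$ where the maximum is over all pairs of intervals of positive integers $I_1=\{i_1,\dots,i_j\}$ and $I_2=\{i_j+q_n+1,\dots,i_j+q_n+k\}$ (so separated by $q_n$ intermediate integers) with $|I_1|\ge q_n$, $|I_2|\ge q_n$ and $i_j+q_n+k\le n$. *)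

theory Defs
  imports "HOL-Probability.Probability" "HOL-Library.Landau_Symbols"
begin

text \<open>A sequence \<open>X\<^sub>1, X\<^sub>2, \<dots>\<close> is a function on \<^typ>\<open>nat\<close> of which only the values at positive
  indices matter; \<open>X 0\<close> is unconstrained throughout.\<close>

definition max_over :: "(nat \<Rightarrow> 'a \<Rightarrow> real) \<Rightarrow> nat set \<Rightarrow> 'a \<Rightarrow> real" where
  "max_over X A \<omega> = Max ((\<lambda>i. X i \<omega>) ` A)"

abbreviation max_between :: "(nat \<Rightarrow> 'a \<Rightarrow> real) \<Rightarrow> nat \<Rightarrow> nat \<Rightarrow> 'a \<Rightarrow> real" where
  "max_between X j k \<equiv> max_over X {j + 1..k}"

definition separated_intervals :: "nat \<Rightarrow> nat \<Rightarrow> (nat set \<times> nat set) set" where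
  "separated_intervals q n =
     {(I1, I2). \<exists>a b k. 1 \<le> a \<and> a \<le> b \<and> 1 \<le> k \<and>
        I1 = {a..b} \<and> I2 = {b + q + 1..b + q + k} \<and>
        q \<le> card I1 \<and> q \<le> card I2 \<and> b + q + k \<le> n}"

text \<open>If \<open>q n = o(n)\<close>, then \<^term>\<open>separated_intervals (q n) n\<close> is nonempty for all large \<open>n\<close>;
  for the remaining \<open>n\<close> the value below is an unspecified real number.\<close>

definition aim_coeff ::
  "'a measure \<Rightarrow> (nat \<Rightarrow> 'a \<Rightarrow> real) \<Rightarrow> (nat \<Rightarrow> real) \<Rightarrow> (nat \<Rightarrow> nat) \<Rightarrow> nat \<Rightarrow> real" where
  "aim_coeff M X x q n =
     Max ((\<lambda>(I1, I2).
       \<bar>\<P>(\<omega> in M. max_over X (I1 \<union> I2) \<omega> \<le> x n)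
         - \<P>(\<omega> in M. max_over X I1 \<omega> \<le> x n) * \<P>(\<omega> in M. max_over X I2 \<omega> \<le> x n)\<bar>)
       ` separated_intervals (q n) n)"

text \<open>\<open>AIM(x\<^sub>n)\<close> with associated sequence \<open>q\<^sub>n\<close>; \<open>AIM(x\<^sub>n)\<close> itself is
  \<open>\<exists>q. AIM_with M X x q\<close>, and the associated \<open>\<alpha>\<^sub>n\<close> is \<^term>\<open>aim_coeff M X x q n\<close>.\<close>

definition AIM_with ::
  "'a measure \<Rightarrow> (nat \<Rightarrow> 'a \<Rightarrow> real) \<Rightarrow> (nat \<Rightarrow> real) \<Rightarrow> (nat \<Rightarrow> nat) \<Rightarrow> bool" where
  "AIM_with M X x q \<longleftrightarrow>
     (\<forall>n\<ge>1. 0 < q n) \<and>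
     (\<lambda>n. real (q n)) \<in> o(\<lambda>n. real n) \<and>
     aim_coeff M X x q \<longlonglongrightarrow> 0"

text \<open>The factor \<open>\<gamma>\<^sub>n\<close>. Conditioning on the null event \<open>X\<^sub>j > x\<^sub>n\<close> gives the
  value 0.\<close>

definition gamma_factor ::
  "'a measure \<Rightarrow> (nat \<Rightarrow> 'a \<Rightarrow> real) \<Rightarrow> (nat \<Rightarrow> real) \<Rightarrow> (nat \<Rightarrow> nat) \<Rightarrow> nat \<Rightarrow> real" where
  "gamma_factor M X x p n =
     (1 / real n) * (\<Sum>j=1..n. \<P>(\<omega> in M. max_between X j (j + p n) \<omega> \<le> x n \<bar> X j \<omega> > x n))"

end

theory Submission
  imports Defs
begin

text \<open>
  The idea is to compare both the probability of no exceedance up to time \<open>n\<close> and the exponential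
  with \<open>exp (- G)\<close>, where \<open>G\<close> is the sum over blocks of the probability that a block contains an
  exceedance. Fix \<open>n\<close>, call \<open>E i = {X i > x n}\<close> the event of an exceedance at
  time \<open>i\<close> and let \<open>\<delta> = 1 - F (x n)\<close> be its probability, so that \<open>n \<delta>\<close> tends to \<open>\<tau>\<close>. Cut
  \<open>{1..n}\<close> into \<open>k\<close> blocks of length \<open>r\<close>, where \<open>r\<close> is much longer than \<open>p n\<close> and much shorter than \<open>n\<close>,
  leaving a remainder shorter than one block.

  \<^item> Mixing makes the blocks nearly independent. Making room for the gaps of length \<open>q n\<close> costs
    \<open>q n * \<delta>\<close> per block, and each application of the mixing condition costs its coefficient \<open>\<alpha>\<close>; the totals are
    negligible (\<open>avoid_blocks\<close>). As a block is hit with probability at most \<open>r \<delta>\<close>, which tends to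
    0, the product of the avoidance probabilities is close to \<open>exp (- G)\<close> (\<open>prod_avoid_approx\<close>).

  \<^item> Decomposing according to the last exceedance in a block turns \<open>G\<close> into a sum over all
    \<open>j\<close> of the probability that \<open>j\<close> is an exceedance with no other exceedance before the end of
    its block. The sum in the theorem asks instead for no exceedance within \<open>p n\<close> steps. Indices
    less than \<open>p n\<close> away from the end of their block are few, as \<open>p n\<close> is short compared with
    \<open>r\<close>. For the other indices the difference is the probability that a run of at least \<open>p n\<close>
    quiet steps after \<open>j\<close> is followed by a further exceedance in the same block.

  \<^item> This last probability cannot be bounded by mixing for each \<open>j\<close> separately: there are \<open>n\<close> indices,
    but only \<open>n \<alpha> = o(p n)\<close> is known. However, for \<open>j\<close> in a window of length \<open>w = p n div 2\<close> the
    events are disjoint, and their union forces an exceedance in the window and another one at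
    distance at least \<open>q n\<close> from the window. One application of mixing per window gives
    \<open>w \<delta> * r \<delta> + \<alpha>\<close> (\<open>sum_later_hit_window_le\<close>), and summing over the \<open>n / w\<close> windows gives
    \<open>n r \<delta>\<^sup>2 + n \<alpha> / w\<close>, which tends to 0.

  With \<open>r = m w\<close> these estimates combine to an explicit inequality for fixed \<open>n\<close>
  (\<open>no_hit_approx\<close>), valid whenever \<open>m\<^sup>2 p n \<le> n\<close>, whose error, as \<open>n \<delta>\<close> is bounded, is of order
  \<open>n \<alpha> / p n + 1 / m\<close>. Letting \<open>m\<close> grow like the square root of \<open>n / p n\<close> proves the first limit.
  The second follows since \<open>n \<gamma>\<^sub>n\<close> is the sum in the exponent divided by \<open>\<delta>\<close> and
  \<open>ln (1 - \<delta>) / \<delta>\<close> tends to \<open>-1\<close>.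
\<close>

section \<open>Elementary inequalities for the exponential\<close>

lemma abs_exp_minus_diff_le:
  fixes s t :: real
  assumes "0 \<le> s" "0 \<le> t"
  shows "\<bar>exp (- s) - exp (- t)\<bar> \<le> \<bar>s - t\<bar>"
proof -
  have *: "exp (- s) - exp (- t) \<le> t - s" if "0 \<le> s" "s \<le> t" for s t :: real
  proof -
    have "exp (- s) - exp (- t) = exp (- s) * (1 - exp (s - t))"
      by (simp add: algebra_simps flip: exp_add)
    also have "\<dots> \<le> 1 * (t - s)"
    proof (rule mult_mono)
      show "1 - exp (s - t) \<le> t - s" using exp_ge_add_one_self[of "s - t"] by linarith
    qed (use that in auto)
    finally show ?thesis by simp
  qed
  show ?thesis using *[of s t] *[of t s] assms by (cases "s \<le> t") auto
qed

lemma abs_one_minus_diff_exp_le: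
  fixes g :: real
  assumes "0 \<le> g" "g \<le> 1"
  shows "\<bar>(1 - g) - exp (- g)\<bar> \<le> g\<^sup>2"
proof -
  have "exp (- g) \<le> 1 - g + g\<^sup>2"
  proof -
    have "exp (- g) \<le> 1 / (1 + g)"
      using exp_ge_add_one_self[of g] assms by (simp add: exp_minus field_simps)
    also have "\<dots> \<le> 1 - g + g\<^sup>2"
      using assms by (simp add: field_simps power2_eq_square)
    finally show ?thesis .
  qed
  then show ?thesis using exp_ge_add_one_self[of "- g"] by simp
qed

text \<open>This passes from \<open>exp (- s)\<close> to a power of \<open>1 - d\<close>: the exponents differ by
  \<open>s * (ln (1 - d) / d + 1)\<close>, and \<open>ln (1 - d)\<close> is within \<open>2 d\<^sup>2\<close> of \<open>- d\<close>.\<close>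

lemma abs_exp_minus_diff_powr_le:
  fixes d s :: real
  assumes "0 < d" "d \<le> 1 / 2" "0 \<le> s"
  shows "\<bar>exp (- s) - (1 - d) powr (s / d)\<bar> \<le> 2 * s * d"
proof -
  define t where "t = - (s / d) * ln (1 - d)"
  have "(1 - d) powr (s / d) = exp (- t)" using assms by (simp add: powr_def t_def)
  moreover have "0 \<le> t"
    using assms by (simp add: t_def divide_nonpos_pos mult_nonneg_nonpos)
  ultimately have "\<bar>exp (- s) - (1 - d) powr (s / d)\<bar> \<le> \<bar>s - t\<bar>"
    using abs_exp_minus_diff_le[of s t] assms by simp
  also have "s - t = s / d * (ln (1 + - d) - - d)"
    using assms by (simp add: t_def field_simps)
  also have "\<bar>\<dots>\<bar> \<le> s / d * (2 * d\<^sup>2)"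
    using assms abs_ln_one_plus_x_minus_x_bound[of "- d"]
    by (simp add: abs_mult divide_right_mono mult_left_mono)
  also have "\<dots> = 2 * s * d" using assms by (simp add: power2_eq_square)
  finally show ?thesis .
qed

section \<open>Sequences of rare events\<close>

locale rare_events = prob_space M for M :: "'a measure" +
  fixes E :: "nat \<Rightarrow> 'a set" and \<delta> :: real
  assumes E_sets [measurable]: "i \<ge> 1 \<Longrightarrow> E i \<in> events"
    and prob_E_le: "i \<ge> 1 \<Longrightarrow> prob (E i) \<le> \<delta>"
begin

definition hit :: "nat \<Rightarrow> nat \<Rightarrow> 'a set" where
  "hit a c = (\<Union>i\<in>{a<..c}. E i)"

lemma hit_sets [measurable]: "hit a c \<in> events"
  unfolding hit_def by (intro sets.finite_UN) auto

lemma hit_empty: "c \<le> a \<Longrightarrow> hit a c = {}"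
  unfolding hit_def by auto

lemma hit_split: "a \<le> b \<Longrightarrow> b \<le> c \<Longrightarrow> hit a c = hit a b \<union> hit b c"
  unfolding hit_def by (simp add: UN_Un[symmetric] ivl_disj_un)

lemma hit_mono: "a' \<le> a \<Longrightarrow> c \<le> c' \<Longrightarrow> hit a c \<subseteq> hit a' c'"
  unfolding hit_def by (intro UN_mono) auto

lemma E_subset_hit: "a < j \<Longrightarrow> j \<le> c \<Longrightarrow> E j \<subseteq> hit a c"
  unfolding hit_def by auto

lemma delta_nonneg: "0 \<le> \<delta>"
  using prob_E_le[of 1] measure_nonneg[of M "E 1"] by linarith

lemma prob_hit_le: "prob (hit a c) \<le> real (c - a) * \<delta>"
proof -
  have "prob (hit a c) \<le> (\<Sum>i\<in>{a<..c}. prob (E i))"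
    unfolding hit_def by (intro finite_measure_subadditive_finite) auto
  also have "\<dots> \<le> of_nat (card {a<..c}) * \<delta>"
    by (intro sum_bounded_above prob_E_le) auto
  finally show ?thesis by simp
qed

lemma prob_Un: "A \<in> events \<Longrightarrow> B \<in> events \<Longrightarrow> prob (A \<union> B) = prob A + prob B - prob (A \<inter> B)"
  using finite_measure_Union'[of A B] finite_measure_Diff'[of B A]
  by (simp add: Int_commute)

definition last_hit :: "nat \<Rightarrow> nat \<Rightarrow> 'a set" where
  "last_hit j c = E j - hit j c"

lemma last_hit_sets [measurable]: "j \<ge> 1 \<Longrightarrow> last_hit j c \<in> events"
  unfolding last_hit_def by measurable

lemma prob_last_hit_le: "j \<ge> 1 \<Longrightarrow> prob (last_hit j c) \<le> \<delta>"
  unfolding last_hit_def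
  by (rule order_trans[OF finite_measure_mono prob_E_le]) auto

text \<open>If some event with index in \<open>{a<..c}\<close> occurs, then exactly one index is that of the last.
  The induction moves the left end \<open>a\<close> because \<open>last_hit j c\<close> depends on the right end only.\<close>

lemma prob_hit_eq_sum_last_hit:
  assumes "a \<le> c"
  shows "prob (hit a c) = (\<Sum>j\<in>{a<..c}. prob (last_hit j c))"
  using assms
proof (induction rule: inc_induct)
  case base
  then show ?case by (simp add: hit_empty)
next
  case (step a)
  have "hit a c = hit (Suc a) c \<union> last_hit (Suc a) c"
  proof -
    have "{a<..Suc a} = {Suc a}" by auto
    then have "hit a (Suc a) = E (Suc a)" by (simp add: hit_def)
    then show ?thesis
      using hit_split[of a "Suc a" c] step.hyps by (auto simp: last_hit_def)
  qed
  moreover have "{a<..c} = insert (Suc a) {Suc a<..c}"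
    using step.hyps by auto
  ultimately show ?case
    using step.IH finite_measure_Union[of "hit (Suc a) c" "last_hit (Suc a) c"]
    by (simp add: last_hit_def[of "Suc a"])
qed

text \<open>Every factor \<open>1 - g\<close> differs from \<open>exp (- g)\<close> by at most \<open>g\<^sup>2 \<le> (r \<delta>)\<^sup>2\<close>, and the distance of
  two products of numbers in \<open>[0, 1]\<close> is at most the sum of the distances of the factors.\<close>

lemma prod_avoid_approx:
  "\<bar>(\<Prod>i<k. 1 - prob (hit (i * r) (i * r + r)))
            - exp (- (\<Sum>i<k. prob (hit (i * r) (i * r + r))))\<bar> \<le> real k * (real r * \<delta>)\<^sup>2"
proof -
  define g where "g i = prob (hit (i * r) (i * r + r))" for i
  have g: "0 \<le> g i" "g i \<le> 1" "g i \<le> real r * \<delta>" for i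
    unfolding g_def using prob_hit_le[of "i * r" "i * r + r"] by auto
  have "exp (- (\<Sum>i<k. g i)) = (\<Prod>i<k. exp (- g i))"
    by (simp add: exp_sum flip: sum_negf)
  then have "\<bar>(\<Prod>i<k. 1 - g i) - exp (- (\<Sum>i<k. g i))\<bar>
      = norm ((\<Prod>i<k. 1 - g i) - (\<Prod>i<k. exp (- g i)))" by simp
  also have "\<dots> \<le> (\<Sum>i<k. norm ((1 - g i) - exp (- g i)))"
    using g by (intro norm_prod_diff) auto
  also have "\<dots> \<le> (\<Sum>i<k. (real r * \<delta>)\<^sup>2)"
  proof (rule sum_mono)
    fix i
    have "norm ((1 - g i) - exp (- g i)) \<le> (g i)\<^sup>2"
      using abs_one_minus_diff_exp_le[of "g i"] g by simp
    also have "\<dots> \<le> (real r * \<delta>)\<^sup>2" using g by (intro power_mono)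
    finally show "norm ((1 - g i) - exp (- g i)) \<le> (real r * \<delta>)\<^sup>2" .
  qed
  finally show ?thesis by (simp add: g_def)
qed

text \<open>For \<open>j + p \<le> c\<close> this is the difference of \<open>last_hit j (j + p)\<close> and \<open>last_hit j c\<close>, that is, the error
  in looking only \<open>p\<close> steps ahead instead of to the end \<open>c\<close> of the block. For \<open>j + p \<ge> c\<close> it is empty.\<close>

definition later_hit :: "nat \<Rightarrow> nat \<Rightarrow> nat \<Rightarrow> 'a set" where
  "later_hit p c j = last_hit j (j + p) \<inter> hit (j + p) c"

lemma later_hit_sets [measurable]: "j \<ge> 1 \<Longrightarrow> later_hit p c j \<in> events"
  unfolding later_hit_def by measurable

end

section \<open>Mixing: independence of blocks and short-range dependence\<close>

text \<open>The mixing condition is phrased for the events that an interval is hit. For the complementary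
  events, in terms of which asymptotic independence of maxima is defined, it is the same condition:
  the covariance of two events does not change when both are replaced by their complements.\<close>

locale mixing_rare_events = rare_events +
  fixes n q :: nat and \<alpha> :: real
  assumes q_pos: "1 \<le> q"
    and alpha_nonneg: "0 \<le> \<alpha>"
    and mixing: "\<And>a b c. a + q \<le> b \<Longrightarrow> b + 2 * q \<le> c \<Longrightarrow> c \<le> n \<Longrightarrow>
      \<bar>prob (hit a b \<inter> hit (b + q) c) - prob (hit a b) * prob (hit (b + q) c)\<bar> \<le> \<alpha>"
begin

text \<open>Mixing applies to intervals with a gap of length \<open>q\<close>. Dropping the first \<open>q\<close> indices of the
  second interval creates this gap; it changes the probability of hitting both intervals and
  the product of the two probabilities by at most \<open>q \<delta>\<close> each.\<close>

lemma avoid_adjacent: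
  assumes "q \<le> b" "b + 2 * q \<le> c" "c \<le> n"
  shows "\<bar>(1 - prob (hit 0 c)) - (1 - prob (hit 0 b)) * (1 - prob (hit b c))\<bar>
           \<le> \<alpha> + 2 * real q * \<delta>"
proof -
  define A B B' D where "A = hit 0 b" "B = hit b c" "B' = hit (b + q) c" "D = hit b (b + q)"
  note defs = this
  have [measurable]: "A \<in> events" "B \<in> events" "B' \<in> events" "D \<in> events"
    by (simp_all add: defs)
  have B: "B = D \<union> B'" unfolding defs using assms by (intro hit_split) auto
  have D: "prob D \<le> real q * \<delta>" unfolding defs using prob_hit_le[of b "b + q"] by simp
  have union: "hit 0 c = A \<union> B" unfolding defs using assms by (intro hit_split) auto
  have prob_union: "prob (A \<union> B) = prob A + prob B - prob (A \<inter> B)"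
    by (intro prob_Un) auto
  have mix: "\<bar>prob (A \<inter> B') - prob A * prob B'\<bar> \<le> \<alpha>"
    unfolding defs using assms by (intro mixing) auto
  have gap: "0 \<le> prob B - prob B'" "prob B - prob B' \<le> real q * \<delta>"
    using D measure_Un_le[of D M B'] finite_measure_mono[of B' B] by (auto simp: B)
  have "prob (A \<inter> B) \<le> prob (A \<inter> B' \<union> D)"
    by (intro finite_measure_mono) (auto simp: B)
  also have "\<dots> \<le> prob (A \<inter> B') + prob D" by (intro measure_Un_le) auto
  finally have int: "prob (A \<inter> B) - prob (A \<inter> B') \<le> real q * \<delta>" using D by simp
  have int': "0 \<le> prob (A \<inter> B) - prob (A \<inter> B')"
    using finite_measure_mono[of "A \<inter> B'" "A \<inter> B"] by (auto simp: B)
  have "prob A * (prob B - prob B') \<le> 1 * (real q * \<delta>)"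
    using gap by (intro mult_mono) auto
  moreover have "0 \<le> prob A * (prob B - prob B')" using gap by simp
  moreover have "(1 - prob (hit 0 c)) - (1 - prob A) * (1 - prob B) =
      (prob (A \<inter> B) - prob (A \<inter> B')) - prob A * (prob B - prob B')
       + (prob (A \<inter> B') - prob A * prob B')"
    unfolding union prob_union by (simp add: algebra_simps)
  ultimately show ?thesis using mix int int' unfolding defs by linarith
qed

text \<open>The blocks are split off from the right one at a time, with an error that does not depend
  on the number of blocks on the left; for this reason the total grows only linearly in \<open>k\<close>.\<close>

lemma avoid_blocks:
  assumes "2 * q \<le> r" "k * r \<le> n"
  shows "\<bar>(1 - prob (hit 0 (k * r))) - (\<Prod>i<k. 1 - prob (hit (i * r) (i * r + r)))\<bar>
           \<le> real k * (\<alpha> + 2 * real q * \<delta>)"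
  using assms(2)
proof (induction k)
  case 0
  then show ?case by (simp add: hit_empty)
next
  case (Suc k)
  let ?P = "\<Prod>i<k. 1 - prob (hit (i * r) (i * r + r))"
  let ?b = "1 - prob (hit (k * r) (k * r + r))"
  let ?e = "\<alpha> + 2 * real q * \<delta>"
  have e: "0 \<le> ?e" using alpha_nonneg delta_nonneg by simp
  have step: "\<bar>(1 - prob (hit 0 (k * r + r))) - (1 - prob (hit 0 (k * r))) * ?b\<bar> \<le> ?e"
  proof (cases "k = 0")
    case True
    then show ?thesis using e by (simp add: hit_empty)
  next
    case False
    then have "r \<le> k * r" by simp
    then have "q \<le> k * r" using assms(1) by linarith
    then show ?thesis using Suc.prems assms(1) by (intro avoid_adjacent) (auto simp: algebra_simps)
  qed
  have "\<bar>(1 - prob (hit 0 (k * r))) * ?b - ?P * ?b\<bar> = \<bar>(1 - prob (hit 0 (k * r))) - ?P\<bar> * ?b"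
    by (simp add: abs_mult flip: left_diff_distrib)
  also have "\<dots> \<le> \<bar>(1 - prob (hit 0 (k * r))) - ?P\<bar>"
    by (intro mult_left_le) auto
  also have "\<dots> \<le> real k * ?e" using Suc by simp
  finally have "\<bar>(1 - prob (hit 0 (k * r + r))) - ?P * ?b\<bar> \<le> ?e + real k * ?e"
    using step by linarith
  then show ?case by (simp add: algebra_simps)
qed

text \<open>The key estimate. Two indices of one window are less than \<open>p\<close> apart, so they cannot both be
  followed by \<open>p\<close> quiet steps: the events are disjoint, and the sum is the probability of their
  union. On the union both the window \<open>{d<..d + w}\<close> and the interval \<open>{d + w + q<..c}\<close> are
  hit, and mixing is needed only once for the whole window.\<close>

lemma sum_later_hit_window_le:
  assumes "q \<le> w" "w + 2 * q \<le> p" "d + w \<le> c" "c \<le> n" "a \<le> d"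
  shows "(\<Sum>j\<in>{d<..d + w}. prob (later_hit p c j))
           \<le> real w * \<delta> * (real (c - a) * \<delta>) + \<alpha>"
proof (cases "c < d + w + 2 * q")
  \<comment> \<open>Here the second interval is too short for mixing, but \<open>j + p \<ge> c\<close> for every \<open>j\<close> in the window.\<close>
  case True
  then have "later_hit p c j = {}" if "j \<in> {d<..d + w}" for j
    using that assms by (auto simp: later_hit_def hit_empty)
  then have "(\<Sum>j\<in>{d<..d + w}. prob (later_hit p c j)) = 0" by simp
  then show ?thesis using alpha_nonneg delta_nonneg by simp
next
  case False
  let ?A = "hit d (d + w)" and ?B = "hit (d + w + q) c"
  have disj: "later_hit p c i \<inter> later_hit p c j = {}" if "i < j" "j \<le> i + p" for i j
    using E_subset_hit[of i j "i + p"] that by (auto simp: later_hit_def last_hit_def)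
  have "disjoint_family_on (later_hit p c) {d<..d + w}"
  proof (unfold disjoint_family_on_def, intro ballI impI)
    fix i j assume "i \<in> {d<..d + w}" "j \<in> {d<..d + w}" "i \<noteq> j"
    then show "later_hit p c i \<inter> later_hit p c j = {}"
      using disj[of i j] disj[of j i] assms by (cases "i < j") (auto simp: Int_commute)
  qed
  then have "(\<Sum>j\<in>{d<..d + w}. prob (later_hit p c j)) = prob (\<Union>j\<in>{d<..d + w}. later_hit p c j)"
    by (intro finite_measure_finite_Union[symmetric]) auto
  also have "\<dots> \<le> prob (?A \<inter> ?B)"
  proof (intro finite_measure_mono UN_least)
    fix j assume j: "j \<in> {d<..d + w}"
    have "E j \<subseteq> ?A" using j by (intro E_subset_hit) auto
    moreover have "hit (j + p) c \<subseteq> ?B" using j assms by (intro hit_mono) auto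
    ultimately show "later_hit p c j \<subseteq> ?A \<inter> ?B" by (auto simp: later_hit_def last_hit_def)
  qed auto
  also have "\<dots> \<le> prob ?A * prob ?B + \<alpha>"
    using mixing[of d "d + w" c] False assms by (simp add: abs_le_iff)
  also have "prob ?A * prob ?B \<le> (real w * \<delta>) * (real (c - a) * \<delta>)"
  proof (rule mult_mono)
    show "prob ?A \<le> real w * \<delta>" using prob_hit_le[of d "d + w"] by simp
    have "prob ?B \<le> real (c - (d + w + q)) * \<delta>" by (rule prob_hit_le)
    also have "\<dots> \<le> real (c - a) * \<delta>"
      using assms by (intro mult_right_mono delta_nonneg) auto
    finally show "prob ?B \<le> real (c - a) * \<delta>" .
  qed (use delta_nonneg in auto)
  finally show ?thesis by simp
qed

lemma sum_later_hit_windows_le: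
  assumes "q \<le> w" "w + 2 * q \<le> p" "a + m * w \<le> c" "c \<le> n"
  shows "(\<Sum>j\<in>{a<..a + m * w}. prob (later_hit p c j))
           \<le> real m * (real w * \<delta> * (real (c - a) * \<delta>) + \<alpha>)"
  using assms(3)
proof (induction m)
  case (Suc m)
  have "{a<..a + Suc m * w} = {a<..a + m * w} \<union> {a + m * w<..a + m * w + w}" by auto
  then have "(\<Sum>j\<in>{a<..a + Suc m * w}. prob (later_hit p c j)) =
      (\<Sum>j\<in>{a<..a + m * w}. prob (later_hit p c j))
        + (\<Sum>j\<in>{a + m * w<..a + m * w + w}. prob (later_hit p c j))"
    by (simp only:) (intro sum.union_disjoint, auto)
  also have "\<dots> \<le> real m * (real w * \<delta> * (real (c - a) * \<delta>) + \<alpha>)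
      + (real w * \<delta> * (real (c - a) * \<delta>) + \<alpha>)"
    using Suc assms by (intro add_mono sum_later_hit_window_le) (auto simp: algebra_simps)
  finally show ?case by (simp add: algebra_simps)
qed simp

text \<open>By \<open>prob_hit_eq_sum_last_hit\<close> the two quantities are sums over the same indices. The summands
  differ by at most \<open>\<delta>\<close> for the at most \<open>p\<close> indices close to the right end, and by the
  probability of \<open>later_hit p c j\<close> for all others.\<close>

lemma sum_last_hit_block:
  assumes "q \<le> w" "w + 2 * q \<le> p" "c = a + m * w" "c \<le> n"
  shows "\<bar>(\<Sum>j\<in>{a<..c}. prob (last_hit j (j + p))) - prob (hit a c)\<bar>
           \<le> real p * \<delta> + real m * (real w * \<delta> * (real (m * w) * \<delta>) + \<alpha>)"
proof -
  have term_le: "\<bar>prob (last_hit j (j + p)) - prob (last_hit j c)\<bar>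
      \<le> (if j \<in> {c - p<..c} then \<delta> else 0) + prob (later_hit p c j)"
    if j: "j \<in> {a<..c}" for j
  proof (cases "j + p \<le> c")
    case True
    then have "last_hit j (j + p) = last_hit j c \<union> later_hit p c j"
      "last_hit j c \<inter> later_hit p c j = {}"
      using hit_split[of j "j + p" c] by (auto simp: last_hit_def later_hit_def)
    then have "prob (last_hit j (j + p)) = prob (last_hit j c) + prob (later_hit p c j)"
      using j by (simp add: finite_measure_Union)
    then show ?thesis using delta_nonneg by simp
  next
    case False
    then have "j \<in> {c - p<..c}" using j by auto
    moreover have "\<bar>prob (last_hit j (j + p)) - prob (last_hit j c)\<bar> \<le> \<delta>"
      using j prob_last_hit_le[of j "j + p"] prob_last_hit_le[of j c]
        measure_nonneg[of M "last_hit j (j + p)"] measure_nonneg[of M "last_hit j c"]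
      by (auto simp: abs_le_iff simp del: measure_nonneg)
    ultimately show ?thesis by (simp add: add_increasing2)
  qed
  have "(\<Sum>j\<in>{a<..c}. prob (last_hit j (j + p))) - prob (hit a c) =
      (\<Sum>j\<in>{a<..c}. prob (last_hit j (j + p)) - prob (last_hit j c))"
    using assms by (subst prob_hit_eq_sum_last_hit) (auto simp: sum_subtractf)
  also have "\<bar>\<dots>\<bar> \<le> (\<Sum>j\<in>{a<..c}. \<bar>prob (last_hit j (j + p)) - prob (last_hit j c)\<bar>)"
    by (rule sum_abs)
  also have "\<dots> \<le> (\<Sum>j\<in>{a<..c}. (if j \<in> {c - p<..c} then \<delta> else 0) + prob (later_hit p c j))"
    by (intro sum_mono term_le)
  also have "\<dots> = \<delta> * real (card ({a<..c} \<inter> {c - p<..c})) + (\<Sum>j\<in>{a<..c}. prob (later_hit p c j))"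
    by (subst sum.distrib, subst sum.inter_restrict[symmetric]) auto
  also have "\<dots> \<le> real p * \<delta> + real m * (real w * \<delta> * (real (m * w) * \<delta>) + \<alpha>)"
  proof (rule add_mono)
    have "card ({a<..c} \<inter> {c - p<..c}) \<le> card {c - p<..c}" by (intro card_mono) auto
    also have "\<dots> \<le> p" by simp
    finally show "\<delta> * real (card ({a<..c} \<inter> {c - p<..c})) \<le> real p * \<delta>"
      using delta_nonneg by (subst mult.commute) (intro mult_right_mono, simp_all)
    show "(\<Sum>j\<in>{a<..c}. prob (later_hit p c j))
      \<le> real m * (real w * \<delta> * (real (m * w) * \<delta>) + \<alpha>)"
      using sum_later_hit_windows_le[of w p a m c] assms by simp
  qed
  finally show ?thesis .
qed

lemma sum_last_hit_blocks:
  assumes "q \<le> w" "w + 2 * q \<le> p" "k * (m * w) \<le> n"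
  shows "\<bar>(\<Sum>j\<in>{0<..k * (m * w)}. prob (last_hit j (j + p)))
            - (\<Sum>i<k. prob (hit (i * (m * w)) (i * (m * w) + m * w)))\<bar>
         \<le> real k * (real p * \<delta> + real m * (real w * \<delta> * (real (m * w) * \<delta>) + \<alpha>))"
  using assms(3)
proof (induction k)
  case (Suc k)
  let ?r = "m * w"
  have "{0<..Suc k * ?r} = {0<..k * ?r} \<union> {k * ?r<..k * ?r + ?r}" by auto
  then have "(\<Sum>j\<in>{0<..Suc k * ?r}. prob (last_hit j (j + p))) =
      (\<Sum>j\<in>{0<..k * ?r}. prob (last_hit j (j + p)))
        + (\<Sum>j\<in>{k * ?r<..k * ?r + ?r}. prob (last_hit j (j + p)))"
    by (simp only:) (intro sum.union_disjoint, auto)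
  moreover have "\<bar>(\<Sum>j\<in>{k * ?r<..k * ?r + ?r}. prob (last_hit j (j + p)))
      - prob (hit (k * ?r) (k * ?r + ?r))\<bar>
      \<le> real p * \<delta> + real m * (real w * \<delta> * (real ?r * \<delta>) + \<alpha>)"
    using assms Suc.prems by (intro sum_last_hit_block) (auto simp: algebra_simps)
  moreover have "\<bar>(\<Sum>j\<in>{0<..k * ?r}. prob (last_hit j (j + p)))
            - (\<Sum>i<k. prob (hit (i * ?r) (i * ?r + ?r)))\<bar>
         \<le> real k * (real p * \<delta> + real m * (real w * \<delta> * (real ?r * \<delta>) + \<alpha>))"
    using Suc by simp
  moreover have "real (Suc k) * z = real k * z + z" for z :: real by (simp add: algebra_simps)
  note this[of "real p * \<delta> + real m * (real w * \<delta> * (real ?r * \<delta>) + \<alpha>)"]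
  ultimately show ?case unfolding sum.lessThan_Suc by linarith
qed simp

text \<open>The windows have length \<open>w = p div 2\<close>: shorter than \<open>p\<close> by at least \<open>2 q\<close>, as the estimate for one
  window requires, yet of the same order as \<open>p\<close>, so that the \<open>n / w\<close> uses of mixing cost only
  \<open>O(n \<alpha> / p)\<close>. Taking \<open>m\<close> windows per block makes \<open>p\<close> at most a fraction \<open>3 / m\<close> of a block, and
  \<open>m\<^sup>2 p \<le> n\<close> makes a block at most a fraction \<open>1 / m\<close> of \<open>{1..n}\<close>; all other errors are
  therefore of order \<open>1 / m\<close>.\<close>

lemma no_hit_approx:
  assumes "4 * q \<le> p" "1 \<le> m" "m * m * p \<le> n"
  shows "\<bar>(1 - prob (hit 0 n)) - exp (- (\<Sum>j\<in>{0<..n}. prob (last_hit j (j + p))))\<bar>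
    \<le> 6 * (real n * \<alpha> / real p) + (8 * (real n * \<delta>) + 2 * (real n * \<delta>)\<^sup>2) / real m"
proof -
  define w where "w = p div 2"
  define r where "r = m * w"
  define k where "k = n div r"
  define g where "g i = prob (hit (i * r) (i * r + r))" for i
  define s where "s j = prob (last_hit j (j + p))" for j
  have w: "q \<le> w" "w + 2 * q \<le> p" "2 * q \<le> w" "p \<le> 3 * w" "w \<le> p" "1 \<le> w" "1 \<le> p"
    using assms q_pos unfolding w_def by linarith+
  have wr: "w \<le> r" using assms by (simp add: r_def)
  have kr: "k * r \<le> n" by (simp add: k_def)
  have "n mod r < r" using wr w by (intro mod_less_divisor) auto
  then have rest: "n - k * r \<le> r" by (simp add: k_def minus_div_mult_eq_mod)
  note d = delta_nonneg and al = alpha_nonneg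

  have 1: "\<bar>(1 - prob (hit 0 n)) - (1 - prob (hit 0 (k * r)))\<bar> \<le> real r * \<delta>"
  proof -
    have "hit 0 n = hit 0 (k * r) \<union> hit (k * r) n" using kr by (intro hit_split) auto
    then have "prob (hit 0 n) \<le> prob (hit 0 (k * r)) + prob (hit (k * r) n)"
      by (simp add: measure_Un_le)
    moreover have "prob (hit (k * r) n) \<le> real r * \<delta>"
      using prob_hit_le[of "k * r" n] rest d
      by (meson mult_right_mono of_nat_le_iff order_trans)
    moreover have "prob (hit 0 (k * r)) \<le> prob (hit 0 n)"
      using kr by (intro finite_measure_mono hit_mono) auto
    ultimately show ?thesis by linarith
  qed
  have 2: "\<bar>(1 - prob (hit 0 (k * r))) - (\<Prod>i<k. 1 - g i)\<bar> \<le> real k * (\<alpha> + 2 * real q * \<delta>)"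
    unfolding g_def using w wr kr by (intro avoid_blocks) auto
  have 3: "\<bar>(\<Prod>i<k. 1 - g i) - exp (- (\<Sum>i<k. g i))\<bar> \<le> real k * (real r * \<delta>)\<^sup>2"
    unfolding g_def by (rule prod_avoid_approx)
  have s: "0 \<le> s j" for j by (simp add: s_def)
  have "\<bar>exp (- (\<Sum>i<k. g i)) - exp (- (\<Sum>j\<in>{0<..n}. s j))\<bar>
      \<le> \<bar>(\<Sum>i<k. g i) - (\<Sum>j\<in>{0<..n}. s j)\<bar>"
    by (intro abs_exp_minus_diff_le sum_nonneg s) (auto simp: g_def)
  also have "\<dots> \<le> real k * (real p * \<delta> + real m * (real w * \<delta> * (real r * \<delta>) + \<alpha>)) + real r * \<delta>"
  proof -
    have "(\<Sum>j\<in>{0<..n}. s j) = (\<Sum>j\<in>{0<..k * r}. s j) + (\<Sum>j\<in>{k * r<..n}. s j)"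
      using kr by (subst sum.union_disjoint[symmetric]) (auto simp: ivl_disj_un)
    moreover have "(\<Sum>j\<in>{k * r<..n}. s j) \<le> real r * \<delta>"
    proof -
      have "(\<Sum>j\<in>{k * r<..n}. s j) \<le> real (card {k * r<..n}) * \<delta>"
        unfolding s_def by (intro sum_bounded_above prob_last_hit_le) auto
      also have "\<dots> \<le> real r * \<delta>" using rest d by (intro mult_right_mono) auto
      finally show ?thesis .
    qed
    moreover have "0 \<le> (\<Sum>j\<in>{k * r<..n}. s j)" by (intro sum_nonneg s)
    moreover have "\<bar>(\<Sum>j\<in>{0<..k * r}. s j) - (\<Sum>i<k. g i)\<bar>
        \<le> real k * (real p * \<delta> + real m * (real w * \<delta> * (real r * \<delta>) + \<alpha>))"
      using sum_last_hit_blocks[of w p k m] w kr by (simp add: s_def g_def r_def)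
    ultimately show ?thesis by linarith
  qed
  finally have 4: "\<bar>exp (- (\<Sum>i<k. g i)) - exp (- (\<Sum>j\<in>{0<..n}. s j))\<bar>
      \<le> real k * (real p * \<delta> + real m * (real w * \<delta> * (real r * \<delta>) + \<alpha>)) + real r * \<delta>" .

  \<comment> \<open>The rest is real arithmetic that bounds the sum of the four errors. It uses
    \<open>k r \<le> n\<close>, \<open>r \<le> n / m\<close> and \<open>k m \<le> 3 n / p\<close>.\<close>
  define K R P W m' N Q where "K = real k" "R = real r" "P = real p" "W = real w" "m' = real m"
    "N = real n" "Q = real q"
  note rdefs = this
  have pos: "0 < P" "0 < W" "1 \<le> m'" "0 \<le> K" "0 < R" "0 \<le> N" "0 \<le> Q"
    using w wr assms unfolding rdefs by auto
  have KR: "K * R \<le> N" unfolding rdefs using kr by (metis of_nat_le_iff of_nat_mult)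
  have R: "R = m' * W" by (simp add: rdefs r_def)
  have PW: "P \<le> 3 * W" "W \<le> P" "2 * Q \<le> P"
    using w assms unfolding rdefs by auto
  have mmP: "m' * m' * P \<le> N" unfolding rdefs using assms by (metis of_nat_le_iff of_nat_mult)
  have Rm: "R \<le> N / m'"
  proof -
    have "R * m' = m' * m' * W" by (simp add: R)
    also have "\<dots> \<le> m' * m' * P" using PW pos by (intro mult_left_mono) auto
    finally have "R * m' \<le> N" using mmP by linarith
    then show ?thesis using pos by (simp add: pos_le_divide_eq)
  qed
  have Km: "K * m' \<le> 3 * N / P"
  proof -
    have "K * m' * P \<le> K * m' * (3 * W)" using PW pos by (intro mult_left_mono) auto
    also have "\<dots> \<le> 3 * N" using KR by (simp add: R)
    finally show ?thesis using pos by (simp add: field_simps)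
  qed
  have KP: "K * P \<le> 3 * N / m'"
    using Km pos by (simp add: field_simps)
  have "\<bar>(1 - prob (hit 0 n)) - exp (- (\<Sum>j\<in>{0<..n}. s j))\<bar>
      \<le> R * \<delta> + K * (\<alpha> + 2 * Q * \<delta>) + K * (R * \<delta>)\<^sup>2
         + (K * (P * \<delta> + m' * (W * \<delta> * (R * \<delta>) + \<alpha>)) + R * \<delta>)"
    using 1 2 3 4 unfolding rdefs by linarith
  also have "\<dots> = 2 * (R * \<delta>) + K * \<alpha> + (K * (2 * Q)) * \<delta> + (K * P) * \<delta>
      + 2 * ((K * R) * R * \<delta>\<^sup>2) + (K * m') * \<alpha>"
    by (simp add: R power2_eq_square algebra_simps)
  also have "\<dots> \<le> 2 * (N / m' * \<delta>) + (3 * N / P) * \<alpha> + (3 * N / m') * \<delta> + (3 * N / m') * \<delta>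
      + 2 * (N * (N / m') * \<delta>\<^sup>2) + (3 * N / P) * \<alpha>"
  proof (intro add_mono mult_left_mono mult_right_mono mult_mono)
    show "K \<le> 3 * N / P" using Km pos mult_left_mono[of 1 m' K] by simp
    show "K * (2 * Q) \<le> 3 * N / m'" using KP PW pos mult_left_mono[of "2 * Q" P K] by simp
  qed (use Rm KR KP Km pos d al in auto)
  also have "\<dots> = 6 * (N * \<alpha> / P) + (8 * (N * \<delta>) + 2 * (N * \<delta>)\<^sup>2) / m'"
    using pos by (simp add: field_simps power2_eq_square)
  finally show ?thesis by (simp add: rdefs s_def)
qed

end

section \<open>Exceedances of a level by random variables\<close>

lemma finite_separated_intervals: "finite (separated_intervals q n)"
proof (rule finite_subset)
  show "separated_intervals q n \<subseteq> Pow {..n} \<times> Pow {..n}"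
    unfolding separated_intervals_def by auto
qed simp

lemma aim_coeff_ge:
  assumes "(I1, I2) \<in> separated_intervals (q n) n"
  shows "\<bar>\<P>(\<omega> in M. max_over X (I1 \<union> I2) \<omega> \<le> x n)
      - \<P>(\<omega> in M. max_over X I1 \<omega> \<le> x n) * \<P>(\<omega> in M. max_over X I2 \<omega> \<le> x n)\<bar>
    \<le> aim_coeff M X x q n"
  unfolding aim_coeff_def
  by (rule Max_ge) (use assms finite_separated_intervals in \<open>auto intro!: rev_image_eqI\<close>)

lemma max_over_le_iff:
  "finite A \<Longrightarrow> A \<noteq> {} \<Longrightarrow> max_over X A \<omega> \<le> u \<longleftrightarrow> (\<forall>i\<in>A. X i \<omega> \<le> u)"
  unfolding max_over_def by (subst Max_le_iff) auto

locale identically_distributed = prob_space M for M :: "'a measure" +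
  fixes X :: "nat \<Rightarrow> 'a \<Rightarrow> real" and F :: "real \<Rightarrow> real"
  assumes X_measurable: "i \<ge> 1 \<Longrightarrow> X i \<in> borel_measurable M"
    and X_cdf: "i \<ge> 1 \<Longrightarrow> cdf (distr M borel (X i)) = F"
begin

definition exceed :: "real \<Rightarrow> nat \<Rightarrow> 'a set" where
  "exceed u i = {\<omega> \<in> space M. u < X i \<omega>}"

lemma exceed_sets: "i \<ge> 1 \<Longrightarrow> exceed u i \<in> events"
  unfolding exceed_def using X_measurable[of i] by measurable

lemma prob_exceed: "i \<ge> 1 \<Longrightarrow> prob (exceed u i) = 1 - F u"
proof -
  assume i: "i \<ge> 1"
  note [measurable] = X_measurable[OF i]
  have "F u = prob {\<omega> \<in> space M. X i \<omega> \<le> u}"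
    unfolding X_cdf[OF i, symmetric] cdf_def
    by (subst measure_distr) (auto intro!: arg_cong[where f = prob])
  moreover have "exceed u i = space M - {\<omega> \<in> space M. X i \<omega> \<le> u}"
    by (auto simp: exceed_def)
  ultimately show ?thesis by (simp add: prob_compl)
qed

sublocale rare_events M "exceed u" "1 - F u" for u
  by unfold_locales (simp_all add: exceed_sets prob_exceed)

lemma prob_max_le:
  assumes "finite A" "A \<noteq> {}" "\<And>i. i \<in> A \<Longrightarrow> 1 \<le> i"
  shows "\<P>(\<omega> in M. max_over X A \<omega> \<le> u) = 1 - prob (\<Union>i\<in>A. exceed u i)"
proof -
  have "{\<omega> \<in> space M. max_over X A \<omega> \<le> u} = space M - (\<Union>i\<in>A. exceed u i)"
    using assms by (auto simp: max_over_le_iff exceed_def not_less)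
  then show ?thesis using assms exceed_sets by (simp add: prob_compl sets.finite_UN)
qed

lemma prob_max_over_interval:
  "a < c \<Longrightarrow> \<P>(\<omega> in M. max_over X {a<..c} \<omega> \<le> u) = 1 - prob (hit u a c)"
  unfolding hit_def by (intro prob_max_le) auto

lemma prob_last_exceedance:
  assumes "1 \<le> p" "1 \<le> j"
  shows "\<P>(\<omega> in M. X j \<omega> > u \<and> max_between X j (j + p) \<omega> \<le> u) = prob (last_hit u j (j + p))"
proof -
  have eq: "{j + 1..j + p} = {j<..j + p}" by auto
  have "{\<omega> \<in> space M. X j \<omega> > u \<and> max_between X j (j + p) \<omega> \<le> u} = last_hit u j (j + p)"
    unfolding eq last_hit_def hit_def
    using assms by (subst max_over_le_iff) (auto simp: exceed_def not_less)
  then show ?thesis by simp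
qed

lemma mixing_rare_events:
  assumes "1 \<le> q n" "3 * q n \<le> n"
  shows "mixing_rare_events M (exceed (x n)) (1 - F (x n)) n (q n) (aim_coeff M X x q n)"
proof
  \<comment> \<open>The maximum is over a nonempty set, since there is room for two intervals of length \<open>q n\<close>.\<close>
  show "0 \<le> aim_coeff M X x q n"
  proof -
    have "({1..q n}, {q n + q n + 1..q n + q n + q n}) \<in> separated_intervals (q n) n"
      unfolding separated_intervals_def using assms by force
    from aim_coeff_ge[where q = q and n = n, OF this, of M X x] show ?thesis by linarith
  qed
  fix a b c assume abc: "a + q n \<le> b" "b + 2 * q n \<le> c" "c \<le> n"
  let ?A = "hit (x n) a b" and ?B = "hit (x n) (b + q n) c"
  have "({a<..b}, {b + q n<..c}) \<in> separated_intervals (q n) n"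
    unfolding separated_intervals_def mem_Collect_eq case_prod_conv
    by (rule exI[of _ "a + 1"], rule exI[of _ b], rule exI[of _ "c - (b + q n)"])
      (use abc assms in auto)
  note aim_coeff_ge[where q = q and n = n, OF this, of M X x]
  moreover have "\<P>(\<omega> in M. max_over X ({a<..b} \<union> {b + q n<..c}) \<omega> \<le> x n) = 1 - prob (?A \<union> ?B)"
    unfolding hit_def UN_Un[symmetric] using abc assms by (intro prob_max_le) auto
  moreover have "\<P>(\<omega> in M. max_over X {a<..b} \<omega> \<le> x n) = 1 - prob ?A"
    using abc assms by (intro prob_max_over_interval) auto
  moreover have "\<P>(\<omega> in M. max_over X {b + q n<..c} \<omega> \<le> x n) = 1 - prob ?B"
    using abc assms by (intro prob_max_over_interval) auto
  moreover have "prob (?A \<union> ?B) = prob ?A + prob ?B - prob (?A \<inter> ?B)"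
    by (intro prob_Un hit_sets)
  ultimately show "\<bar>prob (?A \<inter> ?B) - prob ?A * prob ?B\<bar> \<le> aim_coeff M X x q n"
    by (simp add: algebra_simps)
qed (use assms in auto)

lemma prob_max_approx:
  assumes "1 \<le> q n" "4 * q n \<le> p" "1 \<le> m" "m * m * p \<le> n"
  shows "\<bar>\<P>(\<omega> in M. max_over X {1..n} \<omega> \<le> x n)
      - exp (- (\<Sum>j=1..n. \<P>(\<omega> in M. X j \<omega> > x n \<and> max_between X j (j + p) \<omega> \<le> x n)))\<bar>
    \<le> 6 * (real n * aim_coeff M X x q n / real p)
       + (8 * (real n * (1 - F (x n))) + 2 * (real n * (1 - F (x n)))\<^sup>2) / real m"
proof -
  have "p \<le> m * m * p" using assms by simp
  then have np: "p \<le> n" using assms by linarith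
  interpret mixing_rare_events M "exceed (x n)" "1 - F (x n)" n "q n" "aim_coeff M X x q n"
    using assms np by (intro mixing_rare_events) auto
  have iv: "{1..n} = {0<..n}" by auto
  have "(\<Sum>j\<in>{0<..n}. \<P>(\<omega> in M. X j \<omega> > x n \<and> max_between X j (j + p) \<omega> \<le> x n))
      = (\<Sum>j\<in>{0<..n}. prob (last_hit (x n) j (j + p)))"
    using assms by (intro sum.cong prob_last_exceedance) auto
  moreover have "\<P>(\<omega> in M. max_over X {0<..n} \<omega> \<le> x n) = 1 - prob (hit (x n) 0 n)"
    using assms np by (intro prob_max_over_interval) auto
  ultimately show ?thesis unfolding iv using no_hit_approx[of p m] assms by simp
qed

lemma sum_last_exceedance_bounds:
  assumes "1 \<le> p"
  shows "0 \<le> (\<Sum>j=1..n. \<P>(\<omega> in M. X j \<omega> > u \<and> max_between X j (j + p) \<omega> \<le> u))" (is "0 \<le> ?S")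
    and "(\<Sum>j=1..n. \<P>(\<omega> in M. X j \<omega> > u \<and> max_between X j (j + p) \<omega> \<le> u)) \<le> real n * (1 - F u)"
proof -
  show "0 \<le> ?S" by (intro sum_nonneg) auto
  have "?S = (\<Sum>j=1..n. prob (last_hit u j (j + p)))"
    using assms by (intro sum.cong prob_last_exceedance) auto
  also have "\<dots> \<le> of_nat (card {1..n}) * (1 - F u)"
    by (intro sum_bounded_above prob_last_hit_le) auto
  finally show "?S \<le> real n * (1 - F u)" by simp
qed

lemma gamma_factor_eq:
  assumes "1 \<le> n"
  shows "real n * gamma_factor M X x p n =
    (\<Sum>j=1..n. \<P>(\<omega> in M. X j \<omega> > x n \<and> max_between X j (j + p n) \<omega> \<le> x n)) / (1 - F (x n))"
proof -
  have "\<P>(\<omega> in M. max_between X j (j + p n) \<omega> \<le> x n \<bar> X j \<omega> > x n)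
      = \<P>(\<omega> in M. X j \<omega> > x n \<and> max_between X j (j + p n) \<omega> \<le> x n) / (1 - F (x n))"
    if "j \<in> {1..n}" for j
    using that prob_exceed[of j "x n"]
    by (simp add: cond_prob_def exceed_def conj_commute)
  then have "(\<Sum>j=1..n. \<P>(\<omega> in M. max_between X j (j + p n) \<omega> \<le> x n \<bar> X j \<omega> > x n))
      = (\<Sum>j=1..n. \<P>(\<omega> in M. X j \<omega> > x n \<and> max_between X j (j + p n) \<omega> \<le> x n)) / (1 - F (x n))"
    unfolding sum_divide_distrib by (rule sum.cong[OF refl])
  then show ?thesis
    using assms by (simp add: gamma_factor_def)
qed

end

section \<open>The limit theorem\<close>

theorem theorem2p1:
  fixes M :: "'a measure" and X :: "nat \<Rightarrow> 'a \<Rightarrow> real" and F :: "real \<Rightarrow> real"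
    and x :: "nat \<Rightarrow> real" and \<tau> :: real and p q :: "nat \<Rightarrow> nat"
  assumes "prob_space M"
    and "\<And>i. i \<ge> 1 \<Longrightarrow> X i \<in> borel_measurable M"
    and "\<And>i. i \<ge> 1 \<Longrightarrow> cdf (distr M borel (X i)) = F"
    and "\<tau> > 0"
    and "(\<lambda>n. real n * (1 - F (x n))) \<longlonglongrightarrow> \<tau>"
    and "AIM_with M X x q"
    and "\<And>n. n \<ge> 1 \<Longrightarrow> 0 < p n"
    and "(\<lambda>n. real (p n)) \<in> o(\<lambda>n. real n)"
    and "(\<lambda>n. real n * aim_coeff M X x q n) \<in> o(\<lambda>n. real (p n))"
    and "(\<lambda>n. real (q n)) \<in> o(\<lambda>n. real (p n))"
  shows "((\<lambda>n. \<P>(\<omega> in M. max_over X {1..n} \<omega> \<le> x n)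
             - exp (- (\<Sum>j=1..n. \<P>(\<omega> in M. X j \<omega> > x n \<and> max_between X j (j + p n) \<omega> \<le> x n))))
           \<longlonglongrightarrow> 0)
       \<and> ((\<lambda>n. \<P>(\<omega> in M. max_over X {1..n} \<omega> \<le> x n)
             - F (x n) powr (real n * gamma_factor M X x p n))
           \<longlonglongrightarrow> 0)"
proof -
  interpret prob_space M by fact
  interpret identically_distributed M X F
    by unfold_locales (fact assms)+
  define d where "d n = 1 - F (x n)" for n
  define S where
    "S n = (\<Sum>j=1..n. \<P>(\<omega> in M. X j \<omega> > x n \<and> max_between X j (j + p n) \<omega> \<le> x n))" for n
  \<comment> \<open>The largest choice with \<open>m\<^sup>2 p \<le> n\<close>; it tends to infinity because \<open>p = o(n)\<close>.\<close>
  define m where "m n = nat \<lfloor>sqrt (real n / real (p n))\<rfloor>" for n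
  have nd: "(\<lambda>n. real n * d n) \<longlonglongrightarrow> \<tau>" unfolding d_def by fact
  have ev1: "\<forall>\<^sub>F n in sequentially. 1 \<le> n" by (rule eventually_ge_at_top)

  have ratio: "filterlim (\<lambda>n. real n / real (p n)) at_top sequentially"
  proof -
    have "(\<lambda>n. real (p n) / real n) \<longlonglongrightarrow> 0" by (rule smalloD_tendsto) fact
    moreover have "\<forall>\<^sub>F n in sequentially. 0 < real (p n) / real n"
      using ev1 by eventually_elim (simp add: assms(7))
    ultimately show ?thesis by (drule_tac filterlim_inverse_at_top) (simp_all add: field_simps)
  qed
  have "filterlim (\<lambda>n. sqrt (real n / real (p n))) at_top sequentially"
    by (rule filterlim_compose[OF sqrt_at_top ratio])
  then have m: "filterlim m at_top sequentially"
    unfolding m_def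
    by (intro filterlim_compose[OF filterlim_nat_sequentially]
          filterlim_compose[OF filterlim_floor_sequentially])
  have m_sq: "m n * m n * p n \<le> n" if "1 \<le> n" for n
  proof -
    have pn: "0 < p n" using assms(7) that by simp
    have "real (m n) \<le> sqrt (real n / real (p n))" unfolding m_def by simp
    then have "real (m n) * real (m n) \<le> sqrt (real n / real (p n)) * sqrt (real n / real (p n))"
      by (intro mult_mono) auto
    then have "real (m n * m n) \<le> real n / real (p n)" by simp
    then have "real (m n * m n * p n) \<le> real n" using pn by (simp add: field_simps)
    then show ?thesis by (simp only: of_nat_le_iff)
  qed

  have "(\<lambda>n. real (q n) / real (p n)) \<longlonglongrightarrow> 0" by (rule smalloD_tendsto) fact
  then have "\<forall>\<^sub>F n in sequentially. real (q n) / real (p n) < 1 / 4"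
    by (rule order_tendstoD) simp
  with ev1 have q4: "\<forall>\<^sub>F n in sequentially. 4 * q n \<le> p n"
    by eventually_elim (use assms(7) in \<open>force simp: field_simps\<close>)

  have part1: "(\<lambda>n. \<P>(\<omega> in M. max_over X {1..n} \<omega> \<le> x n) - exp (- S n)) \<longlonglongrightarrow> 0"
  proof (rule Lim_null_comparison)
    have "\<forall>\<^sub>F n in sequentially. 1 \<le> m n" using m by (simp add: filterlim_at_top)
    with q4 ev1 show "\<forall>\<^sub>F n in sequentially.
        norm (\<P>(\<omega> in M. max_over X {1..n} \<omega> \<le> x n) - exp (- S n))
        \<le> 6 * (real n * aim_coeff M X x q n / real (p n))
           + (8 * (real n * d n) + 2 * (real n * d n)\<^sup>2) / real (m n)"
    proof eventually_elim
      case (elim n)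
      then show ?case
        using assms(6) m_sq[of n] unfolding S_def d_def AIM_with_def real_norm_def
        by (intro prob_max_approx) (auto simp: Suc_le_eq)
    qed
    have "(\<lambda>n. real n * aim_coeff M X x q n / real (p n)) \<longlonglongrightarrow> 0"
      by (rule smalloD_tendsto) fact
    moreover have "(\<lambda>n. (8 * (real n * d n) + 2 * (real n * d n)\<^sup>2) / real (m n)) \<longlonglongrightarrow> 0"
      by (rule tendsto_divide_0[OF tendsto_add[OF tendsto_mult[OF tendsto_const nd]
              tendsto_mult[OF tendsto_const tendsto_power[OF nd]]]])
        (rule filterlim_at_top_imp_at_infinity, rule filterlim_compose[OF filterlim_real_sequentially m])
    ultimately show "(\<lambda>n. 6 * (real n * aim_coeff M X x q n / real (p n))
           + (8 * (real n * d n) + 2 * (real n * d n)\<^sup>2) / real (m n)) \<longlonglongrightarrow> 0"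
      using tendsto_add[OF tendsto_mult[OF tendsto_const]] by fastforce
  qed

  have d0: "d \<longlonglongrightarrow> 0"
  proof -
    have "(\<lambda>n. (real n * d n) / real n) \<longlonglongrightarrow> 0"
      by (rule tendsto_divide_0[OF nd])
        (rule filterlim_at_top_imp_at_infinity[OF filterlim_real_sequentially])
    moreover have "\<forall>\<^sub>F n in sequentially. (real n * d n) / real n = d n"
      using ev1 by eventually_elim simp
    ultimately show ?thesis by (simp add: filterlim_cong)
  qed
  have part2: "(\<lambda>n. exp (- S n) - F (x n) powr (real n * gamma_factor M X x p n)) \<longlonglongrightarrow> 0"
  proof (rule Lim_null_comparison)
    have "\<forall>\<^sub>F n in sequentially. 0 < real n * d n"
      using nd \<open>\<tau> > 0\<close> by (rule order_tendstoD)
    moreover have "\<forall>\<^sub>F n in sequentially. d n < 1 / 2"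
      using d0 by (rule order_tendstoD) simp
    ultimately show "\<forall>\<^sub>F n in sequentially.
        norm (exp (- S n) - F (x n) powr (real n * gamma_factor M X x p n))
        \<le> 2 * (real n * d n) * d n"
      using ev1
    proof eventually_elim
      case (elim n)
      have d: "0 < d n" using elim by (simp add: zero_less_mult_iff)
      have p: "1 \<le> p n" using assms(7)[of n] elim by simp
      have S: "0 \<le> S n" "S n \<le> real n * d n"
        unfolding S_def d_def using sum_last_exceedance_bounds[OF p] by auto
      have "norm (exp (- S n) - F (x n) powr (real n * gamma_factor M X x p n))
          = \<bar>exp (- S n) - (1 - d n) powr (S n / d n)\<bar>"
        using gamma_factor_eq[of n x p] elim by (simp add: S_def d_def)
      also have "\<dots> \<le> 2 * S n * d n"
        using d elim S by (intro abs_exp_minus_diff_powr_le) auto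
      also have "\<dots> \<le> 2 * (real n * d n) * d n"
        using S d by (intro mult_right_mono) auto
      finally show ?case .
    qed
    show "(\<lambda>n. 2 * (real n * d n) * d n) \<longlonglongrightarrow> 0"
      using tendsto_mult[OF tendsto_mult[OF tendsto_const[of 2] nd] d0] by simp
  qed
  show ?thesis
    using part1 tendsto_add[OF part1 part2] by (simp add: S_def)
qed

end
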